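(* Let $\mathcal{K}\subset\mathbb{R}^N$ be a convex body. Consider the functions $$\mu_p(x)=\int_{\mathcal{K}}|x-y|^p\,dy,\qquad x\in\mathcal{K},$$ for $p>0$, or $$\nu_p(x)=\int_{\mathbb{R}^N\setminus\mathcal{K}}|x-y|^{-p}\,dy,\qquad x\in\mathcal{K},$$ for $p>N$. Then their minimum points belong to the heart $\heartsuit(\mathcal{K})$.
   Context: A convex body in $\mathbb{R}^N$ is a compact convex set with non-empty interior. The integrals are Lebesgue integrals of nonnegative functions (so $\nu_p$ may take the value $+\infty$). For $\omega\in\mathbb{S}^{N-1}$ (the unit sphere) and $\lambda\in\mathbb{R}$, $T_{\lambda,\omega}$ is the reflection of $\mathbb{R}^N$ in the hyperplane $\{x:\langle x,\omega\rangle=\lambda\}$, and $\mathcal{K}_{\lambda,\omega}=\{x\in\mathcal{K}:\langle x,\omega\rangle\ge\lambda\}$. The maximal folding function is $\mathcal{R}_{\mathcal{K}}(\omega)=\min\{\lambda\in\mathbb{R}: T_{\lambda,\omega}(\mathcal{K}_{\lambda,\omega})\subseteq\mathcal{K}\}$. The heart of $\mathcal{K}$ is $\heartsuit(\mathcal{K})=\{x\in\mathcal{K}:\langle x,\omega\rangle\le\mathcal{R}_{\mathcal{K}}(\omega)\text{ for every }\omega\in\mathbb{S}^{N-1}\}$. *)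

theory Defs
  imports "HOL-Analysis.Analysis"
begin

definition convex_body :: "'a::euclidean_space set \<Rightarrow> bool" where
  "convex_body K \<longleftrightarrow> compact K \<and> convex K \<and> interior K \<noteq> {}"

text \<open>This is the reflection in the hyperplane of all \<open>x\<close> with \<open>x \<bullet> \<omega> = t\<close> only when \<open>norm \<omega> = 1\<close>.\<close>
definition hyp_reflect :: "real \<Rightarrow> 'a::euclidean_space \<Rightarrow> 'a \<Rightarrow> 'a" where
  "hyp_reflect t \<omega> x = x - (2 * (x \<bullet> \<omega> - t)) *\<^sub>R \<omega>"

definition cap :: "'a::euclidean_space set \<Rightarrow> real \<Rightarrow> 'a \<Rightarrow> 'a set" where
  "cap K t \<omega> = {x \<in> K. x \<bullet> \<omega> \<ge> t}"

text \<open>\<open>Least\<close> is the minimum of a set of reals, not an infimum. For a convex body and a unit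
  vector \<open>\<omega>\<close> the minimum exists: the set of admissible \<open>t\<close> is closed, bounded below, and
  nonempty because the cap is empty for large \<open>t\<close>.\<close>
definition max_folding :: "'a::euclidean_space set \<Rightarrow> 'a \<Rightarrow> real" where
  "max_folding K \<omega> = (LEAST t. hyp_reflect t \<omega> ` cap K t \<omega> \<subseteq> K)"

definition heart :: "'a::euclidean_space set \<Rightarrow> 'a set" where
  "heart K = {x \<in> K. \<forall>\<omega>\<in>sphere 0 1. x \<bullet> \<omega> \<le> max_folding K \<omega>}"

definition mu :: "'a::euclidean_space set \<Rightarrow> real \<Rightarrow> 'a \<Rightarrow> ennreal" where
  "mu K p x = (\<integral>\<^sup>+ y\<in>K. ennreal (norm (x - y) powr p) \<partial>lborel)"

text \<open>Only used for \<open>x \<in> K\<close>, where the convention \<open>0 powr a = 0\<close> is irrelevant: the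
  integrand is evaluated at points \<open>y \<noteq> x\<close> only.\<close>
definition nu :: "'a::euclidean_space set \<Rightarrow> real \<Rightarrow> 'a \<Rightarrow> ennreal" where
  "nu K p x = (\<integral>\<^sup>+ y\<in>-K. ennreal (norm (x - y) powr (- p)) \<partial>lborel)"

end

theory Submission
  imports Defs
begin

text \<open>
  Let \<open>x\<close> be a point of \<open>K\<close> outside the heart. Then \<open>max_folding K \<omega> < t < x \<bullet> \<omega>\<close> for some
  unit vector \<open>\<omega>\<close> and some \<open>t\<close>. Write \<open>T\<close> for the reflection at level \<open>t\<close>. By convexity, folding
  at any level above the maximal folding level is admissible, so \<open>T\<close> maps the cap beyond
  level \<open>t\<close> into \<open>K\<close>, and \<open>T x\<close> is a point of \<open>K\<close>. It is a better candidate for the minimum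
  than \<open>x\<close>: the points \<open>y\<close> of \<open>K\<close> split into those with \<open>T y\<close> in \<open>K\<close>, a set
  symmetric under \<open>T\<close> that contributes equally to the potentials at \<open>x\<close> and \<open>T x\<close>, and those with
  \<open>T y\<close> outside \<open>K\<close>, which lie on the side of \<open>T x\<close> and so are closer to \<open>T x\<close> than to \<open>x\<close>.
  The complement of \<open>K\<close> is treated in the same way: its asymmetric part lies on the side of \<open>x\<close>,
  and the kernel of \<open>nu\<close> decreases with the distance. Lemma \<open>nn_integral_fold_less\<close> is the common
  form of both comparisons.

  The comparison is strict because the asymmetric part is not a null set
  (\<open>fold_excess_not_null\<close>). This is the reason for choosing \<open>t\<close> strictly above the maximal folding
  level, at which \<open>K\<close> can be symmetric. Strictness also requires finite potentials. For \<open>mu\<close> the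
  integrand is bounded on \<open>K\<close>. For \<open>nu\<close> the value may be infinite at boundary points, but
  it is finite at interior points as \<open>p\<close> exceeds the dimension, hence also at
  every minimum point.
\<close>

section \<open>Reflections in hyperplanes\<close>

lemma inner_hyp_reflect:
  assumes "norm \<omega> = 1"
  shows "hyp_reflect t \<omega> x \<bullet> \<omega> = 2 * t - x \<bullet> \<omega>"
  using assms by (simp add: hyp_reflect_def inner_diff_left norm_eq_1)

lemma hyp_reflect_involutive:
  assumes "norm \<omega> = 1"
  shows "hyp_reflect t \<omega> (hyp_reflect t \<omega> x) = x"
proof -
  have "hyp_reflect t \<omega> (hyp_reflect t \<omega> x) =
      hyp_reflect t \<omega> x - (2 * (hyp_reflect t \<omega> x \<bullet> \<omega> - t)) *\<^sub>R \<omega>"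
    by (simp add: hyp_reflect_def)
  also have "\<dots> = x"
    unfolding inner_hyp_reflect[OF assms] by (simp add: hyp_reflect_def algebra_simps)
  finally show ?thesis .
qed

lemma dist_hyp_reflect:
  assumes "norm \<omega> = 1"
  shows "dist (hyp_reflect t \<omega> x) (hyp_reflect t \<omega> y) = dist x y"
proof -
  define d where "d = x - y"
  have "hyp_reflect t \<omega> x - hyp_reflect t \<omega> y = d - (2 * (d \<bullet> \<omega>)) *\<^sub>R \<omega>"
    by (simp add: hyp_reflect_def d_def algebra_simps)
  moreover have "(norm (d - (2 * (d \<bullet> \<omega>)) *\<^sub>R \<omega>))\<^sup>2 = (norm d)\<^sup>2"
    using assms unfolding power2_norm_eq_inner norm_eq_1
    by (simp add: inner_diff inner_commute algebra_simps)
  ultimately show ?thesis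
    by (simp add: dist_norm d_def)
qed

text \<open>The sign of the product decides whether reflecting \<open>x\<close> brings it closer to \<open>y\<close>.\<close>

lemma norm_hyp_reflect_diff:
  assumes "norm \<omega> = 1"
  shows "(norm (hyp_reflect t \<omega> x - y))\<^sup>2 = (norm (x - y))\<^sup>2 + 4 * ((x \<bullet> \<omega> - t) * (y \<bullet> \<omega> - t))"
proof -
  define a where "a = x \<bullet> \<omega> - t"
  have "hyp_reflect t \<omega> x - y = (x - y) - (2 * a) *\<^sub>R \<omega>"
    by (simp add: hyp_reflect_def a_def)
  moreover have "(norm ((x - y) - (2 * a) *\<^sub>R \<omega>))\<^sup>2 = (norm (x - y))\<^sup>2 - 4 * a * ((x - y) \<bullet> \<omega>) + 4 * a\<^sup>2"
    using assms unfolding power2_norm_eq_inner norm_eq_1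
    by (simp add: inner_diff inner_commute algebra_simps power2_eq_square)
  ultimately have "(norm (hyp_reflect t \<omega> x - y))\<^sup>2 = (norm (x - y))\<^sup>2 - 4 * a * ((x - y) \<bullet> \<omega>) + 4 * a\<^sup>2"
    by (simp only:)
  then show ?thesis
    by (simp add: a_def inner_diff_left algebra_simps power2_eq_square)
qed

lemma hyp_reflect_closer:
  assumes "norm \<omega> = 1" "x \<bullet> \<omega> > t" "y \<bullet> \<omega> < t"
  shows "norm (hyp_reflect t \<omega> x - y) < norm (x - y)"
proof (rule power2_less_imp_less)
  have "(x \<bullet> \<omega> - t) * (y \<bullet> \<omega> - t) < 0"
    using assms by (simp add: mult_pos_neg)
  then show "(norm (hyp_reflect t \<omega> x - y))\<^sup>2 < (norm (x - y))\<^sup>2"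
    unfolding norm_hyp_reflect_diff[OF assms(1)] by simp
qed simp

lemma hyp_reflect_farther:
  assumes "norm \<omega> = 1" "x \<bullet> \<omega> > t" "y \<bullet> \<omega> > t"
  shows "norm (x - y) < norm (hyp_reflect t \<omega> x - y)"
proof (rule power2_less_imp_less)
  have "(x \<bullet> \<omega> - t) * (y \<bullet> \<omega> - t) > 0"
    using assms by simp
  then show "(norm (x - y))\<^sup>2 < (norm (hyp_reflect t \<omega> x - y))\<^sup>2"
    unfolding norm_hyp_reflect_diff[OF assms(1)] by simp
qed simp

lemma norm_hyp_reflect_swap:
  assumes "norm \<omega> = 1"
  shows "norm (x - hyp_reflect t \<omega> y) = norm (hyp_reflect t \<omega> x - y)"
  using dist_hyp_reflect[OF assms, of t x "hyp_reflect t \<omega> y"]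
  by (simp add: hyp_reflect_involutive[OF assms] dist_norm)


section \<open>Isometric involutions preserve Lebesgue measure\<close>

text \<open>Up to a null set, an open set is a disjoint union of countably many balls by the Vitali
  covering theorem. An isometric involution maps these balls to disjoint balls of the same radii.
  Discarding the image of the null set costs only an inequality, and the same inequality for the
  image of the set is the converse one.\<close>

lemma emeasure_open_le_isometric_image:
  fixes f :: "'a::euclidean_space \<Rightarrow> 'a"
  assumes iso: "\<And>x y. dist (f x) (f y) = dist x y" and inv: "\<And>x. f (f x) = x"
    and "open U"
  shows "emeasure lborel U \<le> emeasure lborel (f ` U)"
proof -
  have ball: "f ` ball c r = ball (f c) r" for c r
  proof
    show "f ` ball c r \<subseteq> ball (f c) r"
      using iso by auto
    show "ball (f c) r \<subseteq> f ` ball c r"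
    proof
      fix y assume "y \<in> ball (f c) r"
      then have "f y \<in> ball c r"
        using iso[of "f c" y] iso[of c "f y"] inv by simp
      then show "y \<in> f ` ball c r"
        by (metis imageI inv)
    qed
  qed
  have "inj f"
    by (metis injI inv)
  have cont: "continuous_on S f" for S
    unfolding continuous_on_iff using iso by metis
  have "open (f -` U)"
    using open_vimage[OF \<open>open U\<close> cont] .
  also have "f -` U = f ` U"
    using inv by (auto intro: rev_image_eqI)
  finally have "open (f ` U)" .
  define I where "I = {i. ball (fst i) (snd i) \<subseteq> U}"
  define B where "B = (\<lambda>i::'a \<times> real. ball (fst i) (snd i))"
  obtain C where C: "countable C" "C \<subseteq> I"
    and disj: "pairwise (\<lambda>i j. disjnt (ball (fst i) (snd i)) (ball (fst j) (snd j))) C"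
    and neg: "negligible (U - (\<Union>i\<in>C. ball (fst i) (snd i)))"
  proof (rule Vitali_covering_theorem_balls[of U I fst snd])
    fix x and d :: real
    assume "x \<in> U" "0 < d"
    then obtain e where "e > 0" "ball x e \<subseteq> U"
      using \<open>open U\<close> openE by blast
    then show "\<exists>i. i \<in> I \<and> x \<in> ball (fst i) (snd i) \<and> snd i < d"
      using \<open>0 < d\<close>
      by (intro exI[of _ "(x, min e (d / 2))"]) (auto simp: I_def)
  qed
  have meas: "B ` C \<subseteq> sets lborel" "(\<lambda>i. f ` B i) ` C \<subseteq> sets lborel"
    by (auto simp: B_def ball)
  have dB: "disjoint_family_on B C"
    using disj by (auto simp: disjoint_family_on_def pairwise_def disjnt_def B_def)
  then have dfB: "disjoint_family_on (\<lambda>i. f ` B i) C"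
    using \<open>inj f\<close> unfolding disjoint_family_on_def by (simp flip: image_Int)
  have sub: "(\<Union>i\<in>C. B i) \<subseteq> U"
    using C(2) by (auto simp: B_def I_def)
  have "open (\<Union>i\<in>C. B i)"
    by (auto simp: B_def)
  then have "U - (\<Union>i\<in>C. B i) \<in> sets lborel"
    using \<open>open U\<close> by simp
  then have null: "U - (\<Union>i\<in>C. B i) \<in> null_sets lborel"
    using neg by (simp add: negligible_iff_null_sets null_sets_completion_iff B_def)
  have "emeasure lborel U = emeasure lborel ((\<Union>i\<in>C. B i) \<union> (U - (\<Union>i\<in>C. B i)))"
    using sub by (simp add: Un_absorb1)
  also have "\<dots> = emeasure lborel (\<Union>i\<in>C. B i)"
    using null C(1) by (intro emeasure_Un_null_set) (auto simp: B_def)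
  also have "\<dots> = (\<integral>\<^sup>+i. emeasure lborel (B i) \<partial>count_space C)"
    using meas(1) dB C(1) by (intro emeasure_UN_countable) auto
  also have "\<dots> = (\<integral>\<^sup>+i. emeasure lborel (f ` B i) \<partial>count_space C)"
  proof (rule nn_integral_cong)
    fix i
    show "emeasure lborel (B i) = emeasure lborel (f ` B i)"
      unfolding B_def ball by (cases "snd i \<ge> 0") (simp_all add: emeasure_ball ball_empty)
  qed
  also have "\<dots> = emeasure lborel (\<Union>i\<in>C. f ` B i)"
    using meas(2) dfB C(1) by (intro emeasure_UN_countable[symmetric]) auto
  also have "\<dots> \<le> emeasure lborel (f ` U)"
    using sub \<open>open (f ` U)\<close> by (intro emeasure_mono) auto
  finally show ?thesis .
qed

lemma distr_lborel_isometric_involution: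
  fixes f :: "'a::euclidean_space \<Rightarrow> 'a"
  assumes iso: "\<And>x y. dist (f x) (f y) = dist x y" and inv: "\<And>x. f (f x) = x"
  shows "distr lborel borel f = lborel"
proof (rule lborel_eqI[symmetric])
  have cont: "continuous_on S f" for S
    unfolding continuous_on_iff using iso by metis
  have [measurable]: "f \<in> borel \<rightarrow>\<^sub>M borel"
    by (rule borel_measurable_continuous_onI[OF cont])
  fix l u :: 'a
  assume "\<And>b. b \<in> Basis \<Longrightarrow> l \<bullet> b \<le> u \<bullet> b"
  have img: "f -` box l u = f ` box l u"
    using inv by (auto intro: rev_image_eqI)
  have op: "open (f ` box l u)"
    using open_vimage[OF open_box cont] img by metis
  have "f ` f ` box l u = box l u"
    using inv by (simp add: image_image)
  then have "emeasure lborel (f ` box l u) = emeasure lborel (box l u)"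
    using emeasure_open_le_isometric_image[OF iso inv op]
      emeasure_open_le_isometric_image[OF iso inv open_box, of l u] by auto
  then show "emeasure (distr lborel borel f) (box l u) = ennreal (\<Prod>b\<in>Basis. (u - l) \<bullet> b)"
    by (simp add: emeasure_distr img emeasure_lborel_box \<open>\<And>b. b \<in> Basis \<Longrightarrow> l \<bullet> b \<le> u \<bullet> b\<close>)
qed simp


section \<open>Folding decreases a potential\<close>

text \<open>Under the involution \<open>T\<close>, the part of \<open>A\<close> whose points have their image in \<open>A\<close> is
  invariant, so on it the integrals of \<open>g\<close> and \<open>g \<circ> T\<close> agree. The rest decides.\<close>

lemma nn_integral_fold_less:
  fixes g :: "'a \<Rightarrow> ennreal"
  assumes T: "T \<in> M \<rightarrow>\<^sub>M M" "distr M M T = M" and inv: "\<And>y. T (T y) = y"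
    and A [measurable]: "A \<in> sets M" and g [measurable]: "g \<in> borel_measurable M"
    and fin: "(\<integral>\<^sup>+y\<in>A. g y \<partial>M) < \<infinity>"
    and less: "\<And>y. y \<in> A \<Longrightarrow> T y \<notin> A \<Longrightarrow> g (T y) < g y"
    and pos: "{y \<in> A. T y \<notin> A} \<notin> null_sets M"
  shows "(\<integral>\<^sup>+y\<in>A. g (T y) \<partial>M) < (\<integral>\<^sup>+y\<in>A. g y \<partial>M)"
proof -
  note [measurable] = T(1)
  define S where "S = {y \<in> A. T y \<in> A}"
  define D where "D = {y \<in> A. T y \<notin> A}"
  have sp: "A \<subseteq> space M"
    using sets.sets_into_space[OF A] .
  have "S = A \<inter> (T -` A \<inter> space M)" "D = A - (T -` A \<inter> space M)"
    using sp by (auto simp: S_def D_def)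
  then have [measurable]: "S \<in> sets M" "D \<in> sets M"
    by auto
  have part: "(\<integral>\<^sup>+y\<in>A. h y \<partial>M) = (\<integral>\<^sup>+y\<in>S. h y \<partial>M) + (\<integral>\<^sup>+y\<in>D. h y \<partial>M)"
    if "h \<in> borel_measurable M" for h :: "'a \<Rightarrow> ennreal"
  proof -
    have "A = S \<union> D" "S \<inter> D = {}"
      by (auto simp: S_def D_def)
    then show ?thesis
      using nn_integral_disjoint_pair[OF that, of S D] by simp
  qed
  have "(\<integral>\<^sup>+y\<in>S. g y \<partial>M) = (\<integral>\<^sup>+y. g y * indicator S y \<partial>distr M M T)"
    by (simp add: T(2))
  also have "\<dots> = (\<integral>\<^sup>+y. g (T y) * indicator S (T y) \<partial>M)"
    by (rule nn_integral_distr) auto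
  also have "\<dots> = (\<integral>\<^sup>+y\<in>S. g (T y) \<partial>M)"
    by (intro nn_integral_cong) (auto simp: S_def inv split: split_indicator)
  finally have S_eq: "(\<integral>\<^sup>+y\<in>S. g (T y) \<partial>M) = (\<integral>\<^sup>+y\<in>S. g y \<partial>M)"
    by simp
  have fin': "(\<integral>\<^sup>+y\<in>S. g y \<partial>M) < \<infinity>" "(\<integral>\<^sup>+y\<in>D. g y \<partial>M) < \<infinity>"
    using fin part[OF g] by (auto simp: ennreal_add_less_top)
  have le: "g (T y) * indicator D y \<le> g y * indicator D y" for y
    using less[of y] by (auto simp: D_def split: split_indicator)
  have "(\<integral>\<^sup>+y\<in>D. g (T y) \<partial>M) < (\<integral>\<^sup>+y\<in>D. g y \<partial>M)"
  proof (rule nn_integral_less)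
    have "(\<integral>\<^sup>+y\<in>D. g (T y) \<partial>M) \<le> (\<integral>\<^sup>+y\<in>D. g y \<partial>M)"
      by (intro nn_integral_mono le)
    then show "(\<integral>\<^sup>+y\<in>D. g (T y) \<partial>M) \<noteq> \<infinity>"
      using fin'(2) by auto
    show "AE y in M. g (T y) * indicator D y \<le> g y * indicator D y"
      using le by simp
    show "\<not> (AE y in M. g y * indicator D y \<le> g (T y) * indicator D y)"
    proof
      assume "AE y in M. g y * indicator D y \<le> g (T y) * indicator D y"
      then have "AE y in M. y \<notin> D"
      proof (rule AE_mp, intro AE_I2 impI notI)
        fix y
        assume "g y * indicator D y \<le> g (T y) * indicator D y" "y \<in> D"
        then show False
          using less[of y] by (auto simp: D_def)
      qed
      then have "D \<in> null_sets M"
        by (simp add: AE_iff_null_sets)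
      then show False
        using pos by (simp add: D_def)
    qed
  qed auto
  then show ?thesis
    using fin'(1) by (simp add: part S_eq ennreal_add_left_cancel_less)
qed


section \<open>The maximal folding function of a convex body\<close>

text \<open>The mirror image of \<open>y\<close> at the level \<open>t\<close> lies on the segment from \<open>y\<close> to its mirror image
  at the lower level \<open>s\<close>.\<close>

lemma fold_level_upward:
  assumes "convex K" "norm \<omega> = 1" "s \<le> t"
    and fold: "hyp_reflect s \<omega> ` cap K s \<omega> \<subseteq> K"
  shows "hyp_reflect t \<omega> ` cap K t \<omega> \<subseteq> K"
proof
  fix z
  assume "z \<in> hyp_reflect t \<omega> ` cap K t \<omega>"
  then obtain y where y: "y \<in> K" "y \<bullet> \<omega> \<ge> t" and z: "z = hyp_reflect t \<omega> y"
    by (auto simp: cap_def)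
  have ys: "hyp_reflect s \<omega> y \<in> K"
    using fold y \<open>s \<le> t\<close> by (auto simp: cap_def)
  show "z \<in> K"
  proof (cases "y \<bullet> \<omega> = s")
    case True
    then have "z = y"
      using y \<open>s \<le> t\<close> by (simp add: z hyp_reflect_def)
    with y show ?thesis by simp
  next
    case False
    define c where "c = (y \<bullet> \<omega> - t) / (y \<bullet> \<omega> - s)"
    have pos: "y \<bullet> \<omega> - s > 0"
      using False y \<open>s \<le> t\<close> by auto
    have c: "0 \<le> c" "c \<le> 1" "c * (y \<bullet> \<omega> - s) = y \<bullet> \<omega> - t"
      using pos y \<open>s \<le> t\<close> by (auto simp: c_def)
    have "(1 - c) *\<^sub>R y + c *\<^sub>R hyp_reflect s \<omega> y = y - (2 * (c * (y \<bullet> \<omega> - s))) *\<^sub>R \<omega>"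
      by (simp add: hyp_reflect_def algebra_simps)
    also have "\<dots> = z"
      unfolding c(3) by (simp add: z hyp_reflect_def)
    finally show ?thesis
      using convexD[OF \<open>convex K\<close> y(1) ys, of "1 - c" c] c by simp
  qed
qed

text \<open>The admissible levels form a closed set bounded below, hence the least one exists and is
  itself admissible.\<close>

lemma max_folding_fold:
  assumes "compact K" "K \<noteq> {}" "norm \<omega> = 1"
  shows "hyp_reflect (max_folding K \<omega>) \<omega> ` cap K (max_folding K \<omega>) \<omega> \<subseteq> K"
proof -
  define P where "P = {t. hyp_reflect t \<omega> ` cap K t \<omega> \<subseteq> K}"
  have "closed K"
    using \<open>compact K\<close> by (rule compact_imp_closed)
  have contw: "continuous_on K (\<lambda>y. y \<bullet> \<omega>)"
    by (intro continuous_intros)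
  obtain a where a: "a \<in> K" "\<And>y. y \<in> K \<Longrightarrow> a \<bullet> \<omega> \<le> y \<bullet> \<omega>"
    using continuous_attains_inf[OF assms(1,2) contw] by blast
  obtain b where b: "b \<in> K" "\<And>y. y \<in> K \<Longrightarrow> y \<bullet> \<omega> \<le> b \<bullet> \<omega>"
    using continuous_attains_sup[OF assms(1,2) contw] by blast
  have "b \<bullet> \<omega> + 1 \<in> P"
    using b(2) by (fastforce simp: P_def cap_def)
  then have ne: "P \<noteq> {}"
    by blast
  have bdd: "a \<bullet> \<omega> \<le> t" if "t \<in> P" for t
  proof (rule ccontr)
    assume less: "\<not> a \<bullet> \<omega> \<le> t"
    then have "hyp_reflect t \<omega> a \<in> K"
      using that a by (auto simp: P_def cap_def)
    then show False
      using a(2)[of "hyp_reflect t \<omega> a"] less by (simp add: inner_hyp_reflect[OF assms(3)])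
  qed
  \<comment> \<open>A point \<open>y\<close> of \<open>K\<close> imposes no condition on levels \<open>t > y \<bullet> \<omega>\<close>. This open ray may be closed up,
    because the reflection at level \<open>y \<bullet> \<omega>\<close> fixes \<open>y\<close>.\<close>
  have "P = (\<Inter>y\<in>K. {y \<bullet> \<omega>..} \<union> (\<lambda>t. hyp_reflect t \<omega> y) -` K)"
  proof (intro equalityI subsetI)
    fix t
    assume "t \<in> P"
    then show "t \<in> (\<Inter>y\<in>K. {y \<bullet> \<omega>..} \<union> (\<lambda>t. hyp_reflect t \<omega> y) -` K)"
      by (force simp: P_def cap_def)
  next
    fix t
    assume t: "t \<in> (\<Inter>y\<in>K. {y \<bullet> \<omega>..} \<union> (\<lambda>t. hyp_reflect t \<omega> y) -` K)"
    have "hyp_reflect t \<omega> y \<in> K" if "y \<in> K" "t \<le> y \<bullet> \<omega>" for y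
    proof (cases "t = y \<bullet> \<omega>")
      case True
      then show ?thesis
        using that by (simp add: hyp_reflect_def)
    next
      case False
      then show ?thesis
        using t that by force
    qed
    then show "t \<in> P"
      by (auto simp: P_def cap_def)
  qed
  moreover have "closed ((\<lambda>t. hyp_reflect t \<omega> y) -` K)" for y
    unfolding hyp_reflect_def by (intro closed_vimage \<open>closed K\<close> continuous_intros)
  ultimately have "closed P"
    by auto
  moreover have "bdd_below P"
    using bdd by (rule bdd_belowI)
  ultimately have "Inf P \<in> P" "\<And>t. t \<in> P \<Longrightarrow> Inf P \<le> t"
    using ne by (auto intro: closed_contains_Inf cInf_lower)
  then have "max_folding K \<omega> = Inf P"
    unfolding max_folding_def by (intro Least_equality) (auto simp: P_def)
  with \<open>Inf P \<in> P\<close> show ?thesis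
    by (simp add: P_def)
qed

text \<open>Let \<open>b\<close> be a point of \<open>K\<close> of maximal height \<open>h\<close> in direction \<open>\<omega>\<close>. Its mirror image at the
  level \<open>s\<close> is in \<open>K\<close> and has height \<open>2 * s - h\<close>, less than \<open>2 * t - h\<close>. So \<open>K\<close> has interior points
  below height \<open>2 * t - h\<close>, and reflecting at level \<open>t\<close> lifts all of these above \<open>h\<close>.\<close>

lemma fold_excess_not_null:
  assumes K: "convex_body K" and \<omega>: "norm \<omega> = 1"
    and fold: "hyp_reflect s \<omega> ` cap K s \<omega> \<subseteq> K" and "s < t"
    and x: "x \<in> K" "t < x \<bullet> \<omega>"
  shows "{y \<in> K. hyp_reflect t \<omega> y \<notin> K} \<notin> null_sets lborel"
proof
  assume null: "{y \<in> K. hyp_reflect t \<omega> y \<notin> K} \<in> null_sets lborel"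
  have "compact K" "convex K" "interior K \<noteq> {}"
    using K by (auto simp: convex_body_def)
  have contw: "continuous_on K (\<lambda>y. y \<bullet> \<omega>)"
    by (intro continuous_intros)
  obtain b where b: "b \<in> K" "\<And>y. y \<in> K \<Longrightarrow> y \<bullet> \<omega> \<le> b \<bullet> \<omega>"
    using continuous_attains_sup[OF \<open>compact K\<close> _ contw] x(1) by blast
  define H where "H = {y. y \<bullet> \<omega> < 2 * t - b \<bullet> \<omega>}"
  have "open H"
    unfolding H_def by (intro open_Collect_less continuous_intros)
  have "hyp_reflect s \<omega> b \<in> K"
    using fold b(1) b(2)[OF x(1)] x(2) \<open>s < t\<close> by (auto simp: cap_def)
  moreover have "hyp_reflect s \<omega> b \<in> H"
    using \<open>s < t\<close> by (simp add: H_def inner_hyp_reflect[OF \<omega>])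
  moreover have "closure (interior K) = K"
    using convex_closure_interior[OF \<open>convex K\<close> \<open>interior K \<noteq> {}\<close>] \<open>compact K\<close>
    by (simp add: compact_imp_closed)
  ultimately have "H \<inter> closure (interior K) \<noteq> {}"
    by auto
  then have "H \<inter> interior K \<noteq> {}"
    using open_Int_closure_eq_empty[OF \<open>open H\<close>] by blast
  moreover have "H \<inter> interior K \<subseteq> {y \<in> K. hyp_reflect t \<omega> y \<notin> K}"
  proof
    fix y
    assume y: "y \<in> H \<inter> interior K"
    then have "hyp_reflect t \<omega> y \<bullet> \<omega> > b \<bullet> \<omega>"
      by (simp add: H_def inner_hyp_reflect[OF \<omega>])
    then show "y \<in> {y \<in> K. hyp_reflect t \<omega> y \<notin> K}"
      using y b(2) interior_subset by (force simp: not_le)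
  qed
  moreover have "negligible {y \<in> K. hyp_reflect t \<omega> y \<notin> K}"
    using null by (simp add: negligible_iff_null_sets null_sets_completionI)
  ultimately show False
    using open_not_negligible[of "H \<inter> interior K"] negligible_subset \<open>open H\<close> by blast
qed

lemma proper_fold_outside_heart:
  assumes K: "convex_body K" and x: "x \<in> K" "x \<notin> heart K"
  obtains \<omega> t where "norm \<omega> = 1" "t < x \<bullet> \<omega>" "hyp_reflect t \<omega> ` cap K t \<omega> \<subseteq> K"
    "{y \<in> K. hyp_reflect t \<omega> y \<notin> K} \<notin> null_sets lborel"
proof -
  have "compact K" "convex K" "K \<noteq> {}"
    using K x by (auto simp: convex_body_def)
  obtain \<omega> where \<omega>: "norm \<omega> = 1" and "max_folding K \<omega> < x \<bullet> \<omega>"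
    using x by (auto simp: heart_def not_le)
  then obtain t where t: "max_folding K \<omega> < t" "t < x \<bullet> \<omega>"
    using dense by blast
  note fold = max_folding_fold[OF \<open>compact K\<close> \<open>K \<noteq> {}\<close> \<omega>]
  show thesis
  proof (rule that)
    show "hyp_reflect t \<omega> ` cap K t \<omega> \<subseteq> K"
      using fold_level_upward[OF \<open>convex K\<close> \<omega> _ fold] t by simp
    show "{y \<in> K. hyp_reflect t \<omega> y \<notin> K} \<notin> null_sets lborel"
      using fold_excess_not_null[OF K \<omega> fold t(1) x(1) t(2)] .
  qed (fact \<omega> t)+
qed


section \<open>Finiteness of the potentials\<close>

lemma mu_finite:
  assumes "compact K" "0 < p"
  shows "mu K p x < \<infinity>"
proof -
  obtain B where B: "\<And>y. y \<in> K \<Longrightarrow> norm (x - y) \<le> B"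
    using compact_imp_bounded[OF \<open>compact K\<close>]
    by (metis bounded_any_center dist_norm)
  have "mu K p x \<le> (\<integral>\<^sup>+y. ennreal (B powr p) * indicator K y \<partial>lborel)"
    unfolding mu_def using B \<open>0 < p\<close>
    by (intro nn_integral_mono) (auto split: split_indicator intro!: ennreal_leI powr_mono2)
  also have "\<dots> = ennreal (B powr p) * emeasure lborel K"
    using compact_imp_closed[OF \<open>compact K\<close>] by (simp add: nn_integral_cmult_indicator)
  also have "\<dots> < \<infinity>"
    using emeasure_bounded_finite[OF compact_imp_bounded[OF \<open>compact K\<close>]]
    by (simp add: ennreal_mult_less_top)
  finally show ?thesis .
qed

text \<open>On the shell where the distance to \<open>x\<close> lies between \<open>2 ^ k * r\<close> and \<open>2 ^ Suc k * r\<close>, the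
  integrand is at most \<open>(2 ^ k * r) powr (- p)\<close>, and the volume of the enclosing ball is of order
  \<open>(2 ^ k * r) ^ DIM('a)\<close>. The products form a geometric series with ratio
  \<open>2 powr (DIM('a) - p) < 1\<close>.\<close>

lemma nn_integral_powr_outside_ball_finite:
  fixes x :: "'a::euclidean_space"
  assumes "p > real DIM('a)" "r > 0"
  shows "(\<integral>\<^sup>+y\<in>-ball x r. ennreal (norm (x - y) powr (- p)) \<partial>lborel) < \<infinity>"
proof -
  define n where "n = DIM('a)"
  define c where "c k = (2 ^ k * r) powr (- p)" for k :: nat
  define B where "B k = ball x (2 ^ Suc k * r)" for k :: nat
  define q where "q = 2 powr (real n - p)"
  have c_nonneg: "c k \<ge> 0" for k
    by (simp add: c_def)
  have [measurable]: "B k \<in> sets lborel" for k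
    by (simp add: B_def)
  have term_le: "h k \<le> (\<Sum>k. h k)" for h :: "nat \<Rightarrow> ennreal" and k
    using sum_le_suminf[OF summableI, of "{k}" h] by simp
  have "ennreal (norm (x - y) powr (- p)) * indicator (- ball x r) y
      \<le> (\<Sum>k. ennreal (c k) * indicator (B k) y)" for y
  proof (cases "y \<in> ball x r")
    case True
    then show ?thesis by simp
  next
    case False
    then have d: "r \<le> norm (x - y)"
      by (simp add: dist_norm)
    obtain m where m: "norm (x - y) / r < 2 ^ m"
      using real_arch_pow[of 2] by auto
    define k where "k = (LEAST k. norm (x - y) / r < 2 ^ Suc k)"
    have "norm (x - y) / r < 2 ^ Suc m"
      using m by (rule less_le_trans) simp
    then have k1: "norm (x - y) / r < 2 ^ Suc k"
      unfolding k_def by (rule LeastI)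
    have k2: "2 ^ k \<le> norm (x - y) / r"
    proof (cases k)
      case 0
      then show ?thesis using d \<open>r > 0\<close> by simp
    next
      case (Suc j)
      then show ?thesis
        using not_less_Least[of j "\<lambda>k. norm (x - y) / r < 2 ^ Suc k"] by (simp add: k_def not_less)
    qed
    have "y \<in> B k"
      using k1 \<open>r > 0\<close> by (simp add: B_def dist_norm field_simps)
    moreover have "norm (x - y) powr (- p) \<le> c k"
      unfolding c_def using k2 \<open>r > 0\<close> assms(1)
      by (intro powr_mono2') (auto simp: field_simps)
    ultimately have "ennreal (norm (x - y) powr (- p)) * indicator (- ball x r) y
        \<le> ennreal (c k) * indicator (B k) y"
      using False by (simp add: ennreal_leI)
    also have "\<dots> \<le> (\<Sum>k. ennreal (c k) * indicator (B k) y)"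
      by (rule term_le)
    finally show ?thesis .
  qed
  then have "(\<integral>\<^sup>+y\<in>-ball x r. ennreal (norm (x - y) powr (- p)) \<partial>lborel)
      \<le> (\<integral>\<^sup>+y. (\<Sum>k. ennreal (c k) * indicator (B k) y) \<partial>lborel)"
    by (intro nn_integral_mono)
  also have "\<dots> = (\<Sum>k. \<integral>\<^sup>+y. ennreal (c k) * indicator (B k) y \<partial>lborel)"
    by (intro nn_integral_suminf) measurable
  also have "\<dots> = (\<Sum>k. ennreal (c k * (unit_ball_vol n * (2 ^ Suc k * r) ^ n)))"
    using \<open>r > 0\<close> c_nonneg
    by (simp add: nn_integral_cmult_indicator B_def emeasure_ball ennreal_mult n_def)
  also have "(\<lambda>k. c k * (unit_ball_vol n * (2 ^ Suc k * r) ^ n))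
      = (\<lambda>k. (unit_ball_vol n * 2 ^ n * r powr (real n - p)) * q ^ k)"
  proof
    fix k :: nat
    have "c k = (2 ^ k) powr (- p) * r powr (- p)"
      using \<open>r > 0\<close> by (simp add: c_def powr_mult)
    moreover have "q ^ k = (2 ^ k) ^ n * (2 ^ k) powr (- p)"
      by (simp add: q_def powr_add[symmetric] powr_realpow[symmetric] powr_powr powr_power algebra_simps)
    moreover have "r powr (real n - p) = r ^ n * r powr (- p)"
      using \<open>r > 0\<close> by (simp add: powr_add[symmetric] powr_realpow[symmetric])
    ultimately show "c k * (unit_ball_vol n * (2 ^ Suc k * r) ^ n)
        = (unit_ball_vol n * 2 ^ n * r powr (real n - p)) * q ^ k"
      by (simp add: power_mult_distrib)
  qed
  also have "(\<Sum>k. ennreal ((unit_ball_vol n * 2 ^ n * r powr (real n - p)) * q ^ k)) < \<infinity>"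
  proof -
    have "q < 1" "q \<ge> 0"
      using assms(1) by (simp_all add: q_def n_def powr_less_one)
    then have "summable (\<lambda>k. (unit_ball_vol n * 2 ^ n * r powr (real n - p)) * q ^ k)"
      by (intro summable_mult summable_geometric) simp
    then show ?thesis
      using \<open>q \<ge> 0\<close> ennreal_suminf_neq_top by (simp add: less_top[symmetric])
  qed
  finally show ?thesis .
qed

lemma nu_finite_interior:
  fixes K :: "'a::euclidean_space set"
  assumes "p > real DIM('a)" "x \<in> interior K"
  shows "nu K p x < \<infinity>"
proof -
  obtain r where r: "r > 0" "ball x r \<subseteq> K"
    using assms(2) mem_interior by blast
  then have "nu K p x \<le> (\<integral>\<^sup>+y\<in>-ball x r. ennreal (norm (x - y) powr (- p)) \<partial>lborel)"
    unfolding nu_def by (intro nn_integral_mono) (auto split: split_indicator)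
  then show ?thesis
    using nn_integral_powr_outside_ball_finite[OF assms(1) r(1), of x] by (rule le_less_trans)
qed


section \<open>Minimum points lie in the heart\<close>

lemma distr_lborel_hyp_reflect:
  assumes "norm \<omega> = 1"
  shows "distr lborel lborel (hyp_reflect t \<omega>) = lborel"
proof -
  have "distr lborel lborel (hyp_reflect t \<omega>) = distr lborel borel (hyp_reflect t \<omega>)"
    by (rule distr_cong) simp_all
  also have "\<dots> = lborel"
    by (rule distr_lborel_isometric_involution)
      (simp_all add: dist_hyp_reflect[OF assms] hyp_reflect_involutive[OF assms])
  finally show ?thesis .
qed

lemma measurable_hyp_reflect: "hyp_reflect t \<omega> \<in> lborel \<rightarrow>\<^sub>M lborel"
  unfolding hyp_reflect_def[abs_def] by simp

lemma mu_fold_less: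
  assumes K: "compact K" and \<omega>: "norm \<omega> = 1" and "0 < p" and x: "t < x \<bullet> \<omega>"
    and fold: "hyp_reflect t \<omega> ` cap K t \<omega> \<subseteq> K"
    and pos: "{y \<in> K. hyp_reflect t \<omega> y \<notin> K} \<notin> null_sets lborel"
  shows "mu K p (hyp_reflect t \<omega> x) < mu K p x"
proof -
  let ?T = "hyp_reflect t \<omega>"
  let ?g = "\<lambda>y. ennreal (norm (x - y) powr p)"
  have "(\<integral>\<^sup>+y\<in>K. ?g (?T y) \<partial>lborel) < (\<integral>\<^sup>+y\<in>K. ?g y \<partial>lborel)"
  proof (rule nn_integral_fold_less)
    show "(\<integral>\<^sup>+y\<in>K. ?g y \<partial>lborel) < \<infinity>"
      using mu_finite[OF K \<open>0 < p\<close>] by (simp add: mu_def)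
    show "?g (?T y) < ?g y" if "y \<in> K" "?T y \<notin> K" for y
    proof -
      have "y \<bullet> \<omega> < t"
        using that fold by (force simp: cap_def)
      then show ?thesis
        using hyp_reflect_closer[OF \<omega> x] \<open>0 < p\<close>
        by (simp add: norm_hyp_reflect_swap[OF \<omega>] ennreal_less_iff powr_less_mono2)
    qed
    show "K \<in> sets lborel"
      using compact_imp_closed[OF K] by simp
  qed (simp_all add: distr_lborel_hyp_reflect \<omega> measurable_hyp_reflect[simplified]
      hyp_reflect_involutive pos)
  then show ?thesis
    by (simp add: mu_def norm_hyp_reflect_swap[OF \<omega>])
qed

lemma nu_fold_less:
  assumes K: "compact K" and \<omega>: "norm \<omega> = 1" and "0 < p" and x: "x \<in> K" "t < x \<bullet> \<omega>"
    and fin: "nu K p x < \<infinity>"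
    and fold: "hyp_reflect t \<omega> ` cap K t \<omega> \<subseteq> K"
    and pos: "{y \<in> K. hyp_reflect t \<omega> y \<notin> K} \<notin> null_sets lborel"
  shows "nu K p (hyp_reflect t \<omega> x) < nu K p x"
proof -
  let ?T = "hyp_reflect t \<omega>"
  let ?g = "\<lambda>y. ennreal (norm (x - y) powr (- p))"
  have "(\<integral>\<^sup>+y\<in>-K. ?g (?T y) \<partial>lborel) < (\<integral>\<^sup>+y\<in>-K. ?g y \<partial>lborel)"
  proof (rule nn_integral_fold_less)
    show "(\<integral>\<^sup>+y\<in>-K. ?g y \<partial>lborel) < \<infinity>"
      using fin by (simp add: nu_def)
    show "?g (?T y) < ?g y" if "y \<in> -K" "?T y \<notin> -K" for y
    proof -
      have "t < y \<bullet> \<omega>"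
      proof (rule ccontr)
        assume "\<not> t < y \<bullet> \<omega>"
        then have "?T y \<in> cap K t \<omega>"
          using that by (simp add: cap_def inner_hyp_reflect[OF \<omega>])
        then have "?T (?T y) \<in> K"
          using fold by blast
        then show False
          using that by (simp add: hyp_reflect_involutive[OF \<omega>])
      qed
      moreover have "0 < norm (x - y)"
        using that x(1) by auto
      ultimately show ?thesis
        using hyp_reflect_farther[OF \<omega> x(2)] \<open>0 < p\<close>
        by (simp add: norm_hyp_reflect_swap[OF \<omega>] ennreal_less_iff powr_less_mono2_neg)
    qed
    show "-K \<in> sets lborel"
      using compact_imp_closed[OF K] by (simp add: open_Compl borel_open)
    \<comment> \<open>The part of the complement without mirror image in it is the mirror image of the
      part of \<open>K\<close> without mirror image in \<open>K\<close>.\<close>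
    show "{y \<in> -K. ?T y \<notin> -K} \<notin> null_sets lborel"
    proof
      let ?D = "{y \<in> K. ?T y \<notin> K}"
      let ?E = "{y \<in> -K. ?T y \<notin> -K}"
      assume null: "?E \<in> null_sets lborel"
      have D: "?D = ?T -` ?E \<inter> space lborel"
        by (auto simp: hyp_reflect_involutive[OF \<omega>])
      have "?D \<in> null_sets lborel"
      proof
        show "?D \<in> sets lborel"
          unfolding D using null by (intro measurable_sets[OF measurable_hyp_reflect]) auto
        have "emeasure lborel ?D = emeasure (distr lborel lborel ?T) ?E"
          unfolding D using null by (intro emeasure_distr[symmetric] measurable_hyp_reflect) auto
        then show "emeasure lborel ?D = 0"
          using null_setsD1[OF null] by (simp only: distr_lborel_hyp_reflect[OF \<omega>])
      qed
      then show False
        using pos by contradiction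
    qed
  qed (simp_all add: distr_lborel_hyp_reflect \<omega> measurable_hyp_reflect[simplified]
      hyp_reflect_involutive)
  then show ?thesis
    by (simp add: nu_def norm_hyp_reflect_swap[OF \<omega>])
qed

theorem corollary3p11:
  fixes K :: "(real ^ 'n) set" and p :: real
  assumes "convex_body K"
  shows "(p > 0 \<longrightarrow> {x. is_arg_min (mu K p) (\<lambda>x. x \<in> K) x} \<subseteq> heart K) \<and>
    (p > real CARD('n) \<longrightarrow> {x. is_arg_min (nu K p) (\<lambda>x. x \<in> K) x} \<subseteq> heart K)"
proof (intro conjI impI subsetI CollectI)
  have "compact K"
    using assms by (simp add: convex_body_def)
  have reflect_mem: "hyp_reflect t \<omega> x \<in> K"
    if "hyp_reflect t \<omega> ` cap K t \<omega> \<subseteq> K" "x \<in> K" "t < x \<bullet> \<omega>" for t x \<omega>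
    using that by (auto simp: cap_def)
  {
    fix x
    assume "p > 0" and "x \<in> {x. is_arg_min (mu K p) (\<lambda>x. x \<in> K) x}"
    then have x: "x \<in> K" and min: "\<And>y. y \<in> K \<Longrightarrow> \<not> mu K p y < mu K p x"
      by (auto simp: is_arg_min_def)
    show "x \<in> heart K"
    proof (rule ccontr)
      assume "x \<notin> heart K"
      with assms x obtain \<omega> t where \<omega>: "norm \<omega> = 1" and t: "t < x \<bullet> \<omega>"
        and fold: "hyp_reflect t \<omega> ` cap K t \<omega> \<subseteq> K"
        and pos: "{y \<in> K. hyp_reflect t \<omega> y \<notin> K} \<notin> null_sets lborel"
        by (rule proper_fold_outside_heart)
      have "mu K p (hyp_reflect t \<omega> x) < mu K p x"
        by (rule mu_fold_less) fact+
      with min[OF reflect_mem[OF fold x t]] show False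
        by contradiction
    qed
  next
    fix x
    assume p: "p > real CARD('n)" and "x \<in> {x. is_arg_min (nu K p) (\<lambda>x. x \<in> K) x}"
    then have x: "x \<in> K" and min: "\<And>y. y \<in> K \<Longrightarrow> \<not> nu K p y < nu K p x"
      by (auto simp: is_arg_min_def)
    obtain z where z: "z \<in> interior K"
      using assms by (auto simp: convex_body_def)
    have "nu K p x \<le> nu K p z"
      using min z interior_subset by (force simp: not_less)
    also have "\<dots> < \<infinity>"
      using p z by (intro nu_finite_interior) simp_all
    finally have fin: "nu K p x < \<infinity>" .
    have "p > 0"
      using p by (rule le_less_trans[rotated]) simp
    show "x \<in> heart K"
    proof (rule ccontr)
      assume "x \<notin> heart K"
      with assms x obtain \<omega> t where \<omega>: "norm \<omega> = 1" and t: "t < x \<bullet> \<omega>"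
        and fold: "hyp_reflect t \<omega> ` cap K t \<omega> \<subseteq> K"
        and pos: "{y \<in> K. hyp_reflect t \<omega> y \<notin> K} \<notin> null_sets lborel"
        by (rule proper_fold_outside_heart)
      have "nu K p (hyp_reflect t \<omega> x) < nu K p x"
        by (rule nu_fold_less) fact+
      with min[OF reflect_mem[OF fold x t]] show False
        by contradiction
    qed
  }
qed

end
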